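(* Let $f:\mathbb{R}^n\to\mathbb{R}$ with the extended-value extension (that is, $f$ takes the value $+\infty$ outside its domain), and let $\mu>0$. If $f$ is strongly convex with parameter $\mu$, then all of the following conditions hold: (i) $\frac12\|s_x\|^2\ge\mu\,(f(x)-f^* )$ for all $x$ and $s_x\in\partial f(x)$, where $f^*=\inf_{y\in\mathbb{R}^n}f(y)$ denotes the minimum value of $f$. (ii) $\|s_y-s_x\|\ge\mu\|y-x\|$ for all $x,y$ and any $s_x\in\partial f(x)$, $s_y\in\partial f(y)$. (iii) $f(y)\le f(x)+s_x^T(y-x)+\frac{1}{2\mu}\|s_y-s_x\|^2$ for all $x,y$ and any $s_x\in\partial f(x)$, $s_y\in\partial f(y)$. (iv) $(s_y-s_x)^T(y-x)\le\frac1\mu\|s_y-s_x\|^2$ for all $x,y$ and any $s_x\in\partial f(x)$, $s_y\in\partial f(y)$.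
   Context: The function $f$ is not assumed differentiable; it is real-valued on its nonempty domain and $+\infty$ outside it. $\|\cdot\|$ is the Euclidean norm. $f$ is strongly convex with parameter $\mu$ if $x\mapsto f(x)-\frac{\mu}{2}x^Tx$ is convex. $\partial f(x)$ denotes the subdifferential of $f$ at $x$, i.e. for $x$ in the domain of $f$, the set of subgradients $s\in\mathbb{R}^n$ with $f(y)\ge f(x)+s^T(y-x)$ for all $y\in\mathbb{R}^n$ (and $\partial f(x)=\emptyset$ for $x$ outside the domain). *)

theory Defs
  imports "HOL-Analysis.Analysis"
begin

(* Extended-value functions take values in ereal; the value \<infinity> marks the points outside
   the domain. The definitions below are meant for functions that satisfy
   real_valued_on_domain, so that -\<infinity> does not occur. *)

definition effective_domain :: "('a \<Rightarrow> ereal) \<Rightarrow> 'a set" where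
  "effective_domain f = {x. f x < \<infinity>}"

definition real_valued_on_domain :: "('a \<Rightarrow> ereal) \<Rightarrow> bool" where
  "real_valued_on_domain f \<longleftrightarrow> (\<forall>x. f x \<noteq> -\<infinity>) \<and> effective_domain f \<noteq> {}"

(* convex_on includes the requirement that the set, here the effective domain, is convex. *)
definition ext_convex :: "('a::real_vector \<Rightarrow> ereal) \<Rightarrow> bool" where
  "ext_convex f \<longleftrightarrow> convex_on (effective_domain f) (\<lambda>x. real_of_ereal (f x))"

definition strongly_convex :: "real \<Rightarrow> ('a::real_inner \<Rightarrow> ereal) \<Rightarrow> bool" where
  "strongly_convex \<mu> f \<longleftrightarrow> ext_convex (\<lambda>x. f x - ereal (\<mu> / 2 * (x \<bullet> x)))"

definition subdifferential :: "('a::real_inner \<Rightarrow> ereal) \<Rightarrow> 'a \<Rightarrow> 'a set" where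
  "subdifferential f x =
     {s. x \<in> effective_domain f \<and> (\<forall>y. f y \<ge> f x + ereal (s \<bullet> (y - x)))}"

end

theory Submission
  imports Defs
begin

text \<open>Strong convexity improves the subgradient inequality by a quadratic term: if
  \<open>s\<close> is a subgradient of \<open>f\<close> at \<open>x\<close>, then
  \<open>f y \<ge> f x + s \<bullet> (y - x) + \<mu>/2 \<parallel>y - x\<parallel>\<^sup>2\<close> for all \<open>y\<close> (lemma
  \<open>strong_subgradient_ineq\<close>). Indeed, along the segment from \<open>x\<close> to \<open>y\<close> the function lies
  below its chord by at least \<open>\<mu>/2 t(1-t) \<parallel>y - x\<parallel>\<^sup>2\<close>, but above the affine function
  given by \<open>s\<close>; dividing by \<open>t\<close> and letting \<open>t\<close> tend to \<open>0\<close> gives the claim.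

  All four conditions follow from this inequality. Completing the square
  (lemma \<open>inner_le_sum_squares\<close>) bounds its right-hand side from below by
  \<open>f x - \<parallel>s\<parallel>\<^sup>2/(2\<mu>)\<close>, uniformly in \<open>y\<close>, which is (i). For (iii), the
  inequality is applied with the roles of the two points exchanged, and the square is completed
  in terms of \<open>sy - sx\<close>. Adding the inequality to its
  exchanged version gives strong monotonicity of the subdifferential,
  \<open>(sy - sx) \<bullet> (y - x) \<ge> \<mu> \<parallel>y - x\<parallel>\<^sup>2\<close>, and then Cauchy-Schwarz gives first (ii)
  and then (iv).\<close>

lemma inner_le_sum_squares:
  fixes w d :: "'a::real_inner"
  assumes "\<mu> > 0"
  shows "w \<bullet> d \<le> \<mu> / 2 * (norm d)\<^sup>2 + 1 / (2 * \<mu>) * (norm w)\<^sup>2"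
proof -
  have "0 \<le> (norm (w - \<mu> *\<^sub>R d))\<^sup>2" by simp
  also have "\<dots> = (norm w)\<^sup>2 - 2 * \<mu> * (w \<bullet> d) + \<mu> * \<mu> * (norm d)\<^sup>2"
    unfolding power2_norm_eq_inner by (simp add: algebra_simps inner_commute)
  finally show ?thesis
    using assms by (simp add: field_simps power2_eq_square)
qed

lemma norm_square_convex_combination:
  fixes x y :: "'a::real_inner"
  shows "((1 - t) *\<^sub>R x + t *\<^sub>R y) \<bullet> ((1 - t) *\<^sub>R x + t *\<^sub>R y)
       = (1 - t) * (x \<bullet> x) + t * (y \<bullet> y) - t * (1 - t) * (norm (y - x))\<^sup>2"
  by (simp add: power2_norm_eq_inner inner_commute algebra_simps)

lemma real_valued_at_domain_point:
  assumes "real_valued_on_domain f" "x \<in> effective_domain f"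
  obtains r where "f x = ereal r"
  using assms by (cases "f x") (auto simp: real_valued_on_domain_def effective_domain_def)

lemma real_valued_at_subgradient_point:
  assumes rv: "real_valued_on_domain f" and s: "s \<in> subdifferential f x"
  obtains r where "f x = ereal r"
proof (rule real_valued_at_domain_point[OF rv])
  show "x \<in> effective_domain f" using s by (simp add: subdifferential_def)
qed (rule that)

text \<open>For \<open>f\<close> itself, convexity of \<open>f - \<mu>/2 \<parallel>_\<parallel>\<^sup>2\<close> means that \<open>f\<close> lies below each
  chord by the quadratic term that \<open>norm_square_convex_combination\<close> produces.\<close>

lemma strongly_convex_below_chord:
  fixes f :: "'a::real_inner \<Rightarrow> ereal"
  assumes rv: "real_valued_on_domain f" and sc: "strongly_convex \<mu> f"
    and fx: "f x = ereal a" and fy: "f y = ereal b" and t: "0 \<le> t" "t \<le> 1"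
  shows "f ((1 - t) *\<^sub>R x + t *\<^sub>R y)
       \<le> ereal ((1 - t) * a + t * b - \<mu> / 2 * (t * (1 - t) * (norm (y - x))\<^sup>2))"
proof -
  define g where "g = (\<lambda>z. f z - ereal (\<mu> / 2 * (z \<bullet> z)))"
  define z where "z = (1 - t) *\<^sub>R x + t *\<^sub>R y"
  have dom: "effective_domain g = effective_domain f"
  proof -
    have "g u < \<infinity> \<longleftrightarrow> f u < \<infinity>" for u
      unfolding g_def by (cases "f u") auto
    then show ?thesis by (simp add: effective_domain_def)
  qed
  have conv: "convex_on (effective_domain f) (\<lambda>u. real_of_ereal (g u))"
    using sc dom by (simp add: strongly_convex_def ext_convex_def g_def)
  have xy: "x \<in> effective_domain f" "y \<in> effective_domain f"
    using fx fy by (simp_all add: effective_domain_def)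
  have "z \<in> effective_domain f"
    using convexD[OF convex_on_imp_convex[OF conv] xy, of "1 - t" t] t by (simp add: z_def)
  then obtain c where fz: "f z = ereal c"
    by (rule real_valued_at_domain_point[OF rv])
  have "real_of_ereal (g z) \<le> (1 - t) * real_of_ereal (g x) + t * real_of_ereal (g y)"
    using convex_onD[OF conv t xy] by (simp add: z_def)
  then have "c - \<mu> / 2 * (z \<bullet> z)
      \<le> (1 - t) * (a - \<mu> / 2 * (x \<bullet> x)) + t * (b - \<mu> / 2 * (y \<bullet> y))"
    by (simp add: g_def fx fy fz)
  moreover have "\<mu> / 2 * (z \<bullet> z) = \<mu> / 2 * ((1 - t) * (x \<bullet> x) + t * (y \<bullet> y)
      - t * (1 - t) * (norm (y - x))\<^sup>2)"
    unfolding z_def norm_square_convex_combination ..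
  ultimately have "c \<le> (1 - t) * a + t * b - \<mu> / 2 * (t * (1 - t) * (norm (y - x))\<^sup>2)"
    by (simp add: algebra_simps diff_divide_distrib)
  then show ?thesis by (simp add: fz flip: z_def)
qed

lemma strong_subgradient_ineq:
  fixes f :: "'a::real_inner \<Rightarrow> ereal"
  assumes rv: "real_valued_on_domain f" and sc: "strongly_convex \<mu> f"
    and s: "s \<in> subdifferential f x"
  shows "f y \<ge> f x + ereal (s \<bullet> (y - x) + \<mu> / 2 * (norm (y - x))\<^sup>2)"
proof (cases "y \<in> effective_domain f")
  case False
  then show ?thesis by (simp add: effective_domain_def)
next
  case True
  have sub: "f x + ereal (s \<bullet> (u - x)) \<le> f u" for u
    using s by (simp add: subdifferential_def)
  obtain a where fx: "f x = ereal a"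
    using real_valued_at_subgradient_point[OF rv s] .
  obtain b where fy: "f y = ereal b"
    using real_valued_at_domain_point[OF rv True] .
  have "\<mu> / 2 * (norm (y - x))\<^sup>2 \<le> b - a - s \<bullet> (y - x)"
  proof (rule field_le_mult_one_interval)
    \<comment> \<open>Here \<open>r\<close> is \<open>1 - t\<close>: the limit \<open>t \<rightarrow> 0\<close> becomes the limit \<open>r \<rightarrow> 1\<close>.\<close>
    fix r :: real assume r: "0 < r" "r < 1"
    define t where "t = 1 - r"
    have t: "0 < t" "t < 1" using r by (auto simp: t_def)
    have "(1 - t) *\<^sub>R x + t *\<^sub>R y - x = t *\<^sub>R (y - x)"
      by (simp add: algebra_simps)
    then have "ereal (a + t * (s \<bullet> (y - x))) \<le> f ((1 - t) *\<^sub>R x + t *\<^sub>R y)"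
      using sub[of "(1 - t) *\<^sub>R x + t *\<^sub>R y"] by (simp add: fx)
    also have "\<dots> \<le> ereal ((1 - t) * a + t * b - \<mu> / 2 * (t * (1 - t) * (norm (y - x))\<^sup>2))"
      using strongly_convex_below_chord[OF rv sc fx fy] t by simp
    finally have "t * (s \<bullet> (y - x)) + t * ((1 - t) * (\<mu> / 2 * (norm (y - x))\<^sup>2)) \<le> t * (b - a)"
      by (simp add: algebra_simps diff_divide_distrib)
    then have "t * (s \<bullet> (y - x) + (1 - t) * (\<mu> / 2 * (norm (y - x))\<^sup>2)) \<le> t * (b - a)"
      by (simp only: distrib_left)
    then have "s \<bullet> (y - x) + (1 - t) * (\<mu> / 2 * (norm (y - x))\<^sup>2) \<le> b - a"
      using t by (simp only: mult_le_cancel_left_pos)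
    then show "r * (\<mu> / 2 * (norm (y - x))\<^sup>2) \<le> b - a - s \<bullet> (y - x)"
      by (simp add: t_def)
  qed
  then show ?thesis by (simp add: fx fy)
qed

text \<open>Minimising the quadratic lower bound at \<open>x\<close> over all \<open>y\<close> bounds the infimum of
  \<open>f\<close> from below. In particular the infimum is a real number, so the extended-real
  difference and product below are ordinary ones.\<close>

lemma strongly_convex_subopt_bound:
  fixes f :: "'a::real_inner \<Rightarrow> ereal"
  assumes rv: "real_valued_on_domain f" and sc: "strongly_convex \<mu> f" and mu: "\<mu> > 0"
    and s: "s \<in> subdifferential f x"
  shows "ereal \<mu> * (f x - (INF y. f y)) \<le> ereal (1 / 2 * (norm s)\<^sup>2)"
proof -
  obtain a where fx: "f x = ereal a"
    using real_valued_at_subgradient_point[OF rv s] .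
  have lower: "ereal (a - 1 / (2 * \<mu>) * (norm s)\<^sup>2) \<le> (INF y. f y)"
  proof (rule INF_greatest)
    fix y
    have "- (s \<bullet> (y - x)) \<le> \<mu> / 2 * (norm (y - x))\<^sup>2 + 1 / (2 * \<mu>) * (norm s)\<^sup>2"
      using inner_le_sum_squares[OF mu, of "- s" "y - x"] by simp
    then have "ereal (a - 1 / (2 * \<mu>) * (norm s)\<^sup>2)
        \<le> f x + ereal (s \<bullet> (y - x) + \<mu> / 2 * (norm (y - x))\<^sup>2)"
      by (simp add: fx)
    also have "\<dots> \<le> f y" by (rule strong_subgradient_ineq[OF rv sc s])
    finally show "ereal (a - 1 / (2 * \<mu>) * (norm s)\<^sup>2) \<le> f y" .
  qed
  have "(INF y. f y) \<le> ereal a"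
    using INF_lower[of x UNIV f] fx by simp
  with lower obtain m where m: "(INF y. f y) = ereal m"
    by (cases "INF y. f y") auto
  have "a - m \<le> 1 / (2 * \<mu>) * (norm s)\<^sup>2"
    using lower by (simp add: m)
  then have "\<mu> * (a - m) \<le> 1 / 2 * (norm s)\<^sup>2"
    using mu by (simp add: field_simps)
  then show ?thesis by (simp add: fx m)
qed

lemma strongly_convex_subdifferential_strongly_monotone:
  fixes f :: "'a::real_inner \<Rightarrow> ereal"
  assumes rv: "real_valued_on_domain f" and sc: "strongly_convex \<mu> f"
    and sx: "sx \<in> subdifferential f x" and sy: "sy \<in> subdifferential f y"
  shows "\<mu> * (norm (y - x))\<^sup>2 \<le> (sy - sx) \<bullet> (y - x)"
proof -
  obtain a where fx: "f x = ereal a"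
    using real_valued_at_subgradient_point[OF rv sx] .
  obtain b where fy: "f y = ereal b"
    using real_valued_at_subgradient_point[OF rv sy] .
  have "a + (sx \<bullet> (y - x) + \<mu> / 2 * (norm (y - x))\<^sup>2) \<le> b"
    using strong_subgradient_ineq[OF rv sc sx, of y] by (simp add: fx fy)
  moreover have "b + (sy \<bullet> (x - y) + \<mu> / 2 * (norm (y - x))\<^sup>2) \<le> a"
    using strong_subgradient_ineq[OF rv sc sy, of x] by (simp add: fx fy norm_minus_commute)
  ultimately show ?thesis by (simp add: inner_diff_left inner_diff_right)
qed

text \<open>The subgradient inequality based at \<open>y\<close> gives
  \<open>f y \<le> f x + sy \<bullet> (y - x) - \<mu>/2 \<parallel>y - x\<parallel>\<^sup>2\<close>. Replacing \<open>sy\<close> by \<open>sx\<close> leaves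
  \<open>(sy - sx) \<bullet> (y - x) - \<mu>/2 \<parallel>y - x\<parallel>\<^sup>2\<close>, which is concave quadratic in \<open>y - x\<close> with
  maximum \<open>\<parallel>sy - sx\<parallel>\<^sup>2/(2\<mu>)\<close>.\<close>

lemma strongly_convex_upper_bound:
  fixes f :: "'a::real_inner \<Rightarrow> ereal"
  assumes rv: "real_valued_on_domain f" and sc: "strongly_convex \<mu> f" and mu: "\<mu> > 0"
    and sx: "sx \<in> subdifferential f x" and sy: "sy \<in> subdifferential f y"
  shows "f y \<le> f x + ereal (sx \<bullet> (y - x)) + ereal (1 / (2 * \<mu>) * (norm (sy - sx))\<^sup>2)"
proof -
  obtain a where fx: "f x = ereal a"
    using real_valued_at_subgradient_point[OF rv sx] .
  obtain b where fy: "f y = ereal b"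
    using real_valued_at_subgradient_point[OF rv sy] .
  have "b + (sy \<bullet> (x - y) + \<mu> / 2 * (norm (y - x))\<^sup>2) \<le> a"
    using strong_subgradient_ineq[OF rv sc sy, of x] by (simp add: fx fy norm_minus_commute)
  moreover have "(sy - sx) \<bullet> (y - x)
      \<le> \<mu> / 2 * (norm (y - x))\<^sup>2 + 1 / (2 * \<mu>) * (norm (sy - sx))\<^sup>2"
    by (rule inner_le_sum_squares[OF mu])
  ultimately have "b \<le> a + sx \<bullet> (y - x) + 1 / (2 * \<mu>) * (norm (sy - sx))\<^sup>2"
    unfolding inner_diff_left inner_diff_right by linarith
  then show ?thesis by (simp add: fx fy)
qed

lemma strongly_monotone_imp_norm_bound:
  fixes w d :: "'a::real_inner"
  assumes "\<mu> * (norm d)\<^sup>2 \<le> w \<bullet> d"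
  shows "\<mu> * norm d \<le> norm w"
proof (cases "d = 0")
  case False
  have "(\<mu> * norm d) * norm d \<le> norm w * norm d"
    using assms norm_cauchy_schwarz[of w d] by (simp add: power2_eq_square mult.assoc)
  with False show ?thesis by simp
qed simp

lemma strongly_monotone_imp_inner_bound:
  fixes w d :: "'a::real_inner"
  assumes "\<mu> > 0" "\<mu> * (norm d)\<^sup>2 \<le> w \<bullet> d"
  shows "w \<bullet> d \<le> 1 / \<mu> * (norm w)\<^sup>2"
proof -
  have "norm d \<le> norm w / \<mu>"
    using strongly_monotone_imp_norm_bound[OF assms(2)] assms(1) by (simp add: field_simps)
  then have "norm w * norm d \<le> norm w * (norm w / \<mu>)"
    by (rule mult_left_mono) simp
  then show ?thesis
    using norm_cauchy_schwarz[of w d] by (simp add: power2_eq_square)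
qed

theorem lemma3:
  fixes f :: "real ^ 'n \<Rightarrow> ereal" and \<mu> :: real
  assumes "real_valued_on_domain f"
    and "\<mu> > 0"
    and "strongly_convex \<mu> f"
  shows "(\<forall>x. \<forall>sx \<in> subdifferential f x.
            ereal (1 / 2 * (norm sx)\<^sup>2) \<ge> ereal \<mu> * (f x - (INF y. f y)))
       \<and> (\<forall>x y. \<forall>sx \<in> subdifferential f x. \<forall>sy \<in> subdifferential f y.
            norm (sy - sx) \<ge> \<mu> * norm (y - x))
       \<and> (\<forall>x y. \<forall>sx \<in> subdifferential f x. \<forall>sy \<in> subdifferential f y.
            f y \<le> f x + ereal (sx \<bullet> (y - x)) + ereal (1 / (2 * \<mu>) * (norm (sy - sx))\<^sup>2))
       \<and> (\<forall>x y. \<forall>sx \<in> subdifferential f x. \<forall>sy \<in> subdifferential f y.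
            (sy - sx) \<bullet> (y - x) \<le> 1 / \<mu> * (norm (sy - sx))\<^sup>2)"
  using strongly_convex_subopt_bound[OF assms(1,3,2)]
    strongly_monotone_imp_norm_bound[OF
      strongly_convex_subdifferential_strongly_monotone[OF assms(1,3)]]
    strongly_convex_upper_bound[OF assms(1,3,2)]
    strongly_monotone_imp_inner_bound[OF assms(2)
      strongly_convex_subdifferential_strongly_monotone[OF assms(1,3)]]
  by blast

end
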